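(* The following identities of meromorphic functions of $\tau\in\mathbb{H}$ hold: $$\frac{\vartheta_2^2(\pi/8,\tau)}{\vartheta_3^2(\pi/8,\tau)}+\frac{\vartheta_2^2(3\pi/8,\tau)}{\vartheta_3^2(3\pi/8,\tau)}=\frac{8\vartheta_2(0,4\tau)}{\vartheta_2^2(0,\tau)\vartheta_3^2(0,\tau)}\cdot\frac{\vartheta_3^4(0,4\tau)-\vartheta_2^4(0,4\tau)}{\vartheta_3(0,4\tau)-\vartheta_2(0,4\tau)}$$ and $$\frac{\vartheta_2^2(\pi/8,\tau)}{\vartheta_3^2(\pi/8,\tau)}\cdot\frac{\vartheta_2^2(3\pi/8,\tau)}{\vartheta_3^2(3\pi/8,\tau)}=\frac{\vartheta_2(0,4\tau)}{\vartheta_3(0,4\tau)}.$$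
   Context: $\mathbb{H}$ is the open upper half plane. For $\tau\in\mathbb{H}$, with $q=e^{2\pi i\tau}$ and $q^s=e^{2\pi i s\tau}$, $$\vartheta_2(v,\tau)=\sum_{m=-\infty}^\infty q^{(m+1/2)^2}e^{(2m+1)iv},\qquad \vartheta_3(v,\tau)=\sum_{m=-\infty}^\infty q^{m^2}e^{2miv}.$$ *)

theory Defs
  imports "HOL-Complex_Analysis.Complex_Analysis"
begin

definition upper_half_plane :: "complex set" where
  "upper_half_plane = {\<tau>. Im \<tau> > 0}"

(* q^s with q = exp(2 pi i tau). The nome is q itself: the classical theta functions with
   nome exp(pi i tau) are these at tau / 2. *)
definition q_pow :: "complex \<Rightarrow> complex \<Rightarrow> complex" where
  "q_pow \<tau> s = exp (2 * of_real pi * \<i> * s * \<tau>)"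

(* For tau in the upper half plane both bilateral series converge absolutely, so the unordered
   sum over int is the usual one. *)
definition theta2 :: "complex \<Rightarrow> complex \<Rightarrow> complex" where
  "theta2 v \<tau> =
     (\<Sum>\<^sub>\<infinity>m::int. q_pow \<tau> ((of_int m + 1/2)\<^sup>2) * exp ((2 * of_int m + 1) * \<i> * v))"

definition theta3 :: "complex \<Rightarrow> complex \<Rightarrow> complex" where
  "theta3 v \<tau> =
     (\<Sum>\<^sub>\<infinity>m::int. q_pow \<tau> ((of_int m)\<^sup>2) * exp (2 * of_int m * \<i> * v))"

(* The library's meromorphic_on ignores values on discrete sets, and x / 0 = 0. Here equality is
   required at every point of S, which implies equality as meromorphic functions. *)
definition meromorphic_identity_on ::
    "complex set \<Rightarrow> (complex \<Rightarrow> complex) \<Rightarrow> (complex \<Rightarrow> complex) \<Rightarrow> bool" where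
  "meromorphic_identity_on S f g \<longleftrightarrow>
     f meromorphic_on S \<and> g meromorphic_on S \<and> (\<forall>z\<in>S. f z = g z)"

end

theory Submission
  imports Defs "HOL-Real_Asymp.Real_Asymp"
begin

text \<open>
  Everything is reduced to the two numbers p = \<open>\<vartheta>\<^sub>2(0,4\<tau>)\<close> and r = \<open>\<vartheta>\<^sub>3(0,4\<tau>)\<close> by means of the
  duplication formulas for theta functions. Substituting (m,n) = (j+k,j-k) or (j+k+1,j-k) in a
  double series turns the quadratic form \<open>m\<^sup>2 + n\<^sup>2\<close> into \<open>2(j\<^sup>2 + k\<^sup>2)\<close>, up to shifts of j and k by 1/2, so that a product of two
  theta values at \<open>\<tau>\<close> becomes a sum of two products of theta values at \<open>2\<tau>\<close>, with arguments
  x+y and x-y (\<open>theta_char_product\<close>).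

  For x = \<open>3\<pi>/8\<close> and y = \<open>\<pi>/8\<close> one has x+y = \<open>\<pi>/2\<close>, where \<open>\<vartheta>\<^sub>2\<close> vanishes; half of each
  formula disappears, and a second application at x = y = \<open>\<pi>/4\<close> gives the same effect. Hence the
  product of the two quotients is p/r after cancelling a common factor. For the sum, the
  numerator over the common denominator is bilinear in the squares of the theta values at \<open>\<pi>/8\<close> and
  \<open>3\<pi>/8\<close>. These squares are given by duplication with x = y, and the mixed terms cancel because
  \<open>3\<pi>/4 = \<pi> - \<pi>/4\<close> (\<open>theta_quotient_sum\<close>). With \<open>\<vartheta>\<^sub>3(0,\<tau>) = r + p\<close>,
  \<open>\<vartheta>\<^sub>3(\<pi>/2,\<tau>) = r - p\<close> and \<open>\<vartheta>\<^sub>2(0,\<tau>)\<^sup>4 = 8pr(r\<^sup>2 + p\<^sup>2)\<close> (\<open>theta_null_values\<close>) both sides become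
  the same rational function of p, r and \<open>\<vartheta>\<^sub>2(0,\<tau>)\<^sup>2\<close>.

  Equality at every point also requires that no denominator vanishes. Instead of the
  triple product, this uses the duplication formulas again: a zero of \<open>\<vartheta>\<^sub>3(\<pi>/2,\<cdot>)\<close> at \<open>\<tau>\<close> forces
  zeros at \<open>2\<tau>, 4\<tau>, 8\<tau>, \<dots>\<close>, which contradicts the limit 1 of the series as the imaginary part
  tends to infinity (\<open>nonzero_by_doubling\<close>). As \<open>\<vartheta>\<^sub>3(0,\<tau>)\<close> divides the square of
  \<open>\<vartheta>\<^sub>3(\<pi>/2,2\<tau>)\<close>, it does not vanish either, and then \<open>\<vartheta>\<^sub>2(0,\<tau>)\<close> is treated by doubling. Meromorphy holds since each theta function is holomorphic in \<open>\<tau>\<close>.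
\<close>

section \<open>Theta series with characteristic\<close>

text \<open>
  The characteristic a treats \<open>\<vartheta>\<^sub>3\<close> (a = 0) and \<open>\<vartheta>\<^sub>2\<close> (a = 1/2) at once. The argument v is kept
  real, which makes the factor depending on v unimodular and all bounds independent of v.
\<close>

definition theta_term :: "real \<Rightarrow> real \<Rightarrow> complex \<Rightarrow> int \<Rightarrow> complex" where
  "theta_term a v \<tau> m =
     exp (2 * of_real pi * \<i> * of_real ((of_int m + a)\<^sup>2) * \<tau>) *
     exp (2 * \<i> * of_real ((of_int m + a) * v))"

definition theta_char :: "real \<Rightarrow> real \<Rightarrow> complex \<Rightarrow> complex" where
  "theta_char a v \<tau> = (\<Sum>\<^sub>\<infinity>m::int. theta_term a v \<tau> m)"

lemma theta3_eq_theta_char: "theta3 (of_real v) \<tau> = theta_char 0 v \<tau>"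
  unfolding theta3_def theta_char_def theta_term_def q_pow_def
  by (simp add: mult_ac)

lemma theta2_eq_theta_char: "theta2 (of_real v) \<tau> = theta_char (1/2) v \<tau>"
  unfolding theta2_def theta_char_def theta_term_def q_pow_def
  by (intro infsum_cong) (simp add: algebra_simps)

lemma norm_theta_term:
  "norm (theta_term a v \<tau> m) = exp (- (2 * pi * Im \<tau>) * (of_int m + a)\<^sup>2)"
  by (simp add: theta_term_def norm_mult mult_ac power2_eq_square[of "of_int m + a"])

section \<open>Convergence and holomorphy\<close>

lemma summable_on_int_power_abs:
  fixes r :: real
  assumes "0 \<le> r" "r < 1"
  shows "(\<lambda>m::int. r ^ nat \<bar>m\<bar>) summable_on UNIV"
proof -
  have geo: "(\<lambda>n::nat. r ^ n) summable_on UNIV"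
    using assms by (intro norm_summable_imp_summable_on) (auto intro: summable_geometric)
  have pos: "(\<lambda>m::int. r ^ nat \<bar>m\<bar>) summable_on range int"
    by (subst summable_on_reindex) (use geo in \<open>auto simp: o_def\<close>)
  have neg: "(\<lambda>m::int. r ^ nat \<bar>m\<bar>) summable_on range (\<lambda>n. - int n)"
    by (subst summable_on_reindex) (use geo in \<open>auto simp: o_def inj_on_def\<close>)
  have "range int \<union> range (\<lambda>n. - int n) = UNIV"
  proof (intro equalityI subsetI)
    fix m :: int
    assume "m \<in> UNIV"
    show "m \<in> range int \<union> range (\<lambda>n. - int n)"
      by (cases m rule: int_cases2) auto
  qed auto
  with summable_on_union[OF pos neg] show ?thesis by simp
qed

text \<open>
  Comparison with a geometric series, using \<open>x\<^sup>2 \<ge> \<bar>x\<bar> - 1\<close>.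
\<close>

lemma summable_on_gaussian:
  fixes a c :: real
  assumes "c > 0"
  shows "(\<lambda>m::int. exp (- c * (of_int m + a)\<^sup>2)) summable_on UNIV"
proof (rule summable_on_comparison_test)
  show "(\<lambda>m::int. exp (c * (\<bar>a\<bar> + 1)) * exp (- c) ^ nat \<bar>m\<bar>) summable_on UNIV"
    by (intro summable_on_cmult_right summable_on_int_power_abs) (use assms in auto)
  fix m :: int
  have "\<bar>of_int m + a\<bar> - 1 \<le> (of_int m + a)\<^sup>2"
    using zero_le_power2[of "\<bar>of_int m + a\<bar> - 1/2"] by (simp add: power2_eq_square algebra_simps)
  then have "\<bar>of_int m\<bar> - (\<bar>a\<bar> + 1) \<le> (of_int m + a)\<^sup>2"
    by linarith
  then have "c * (\<bar>of_int m\<bar> - (\<bar>a\<bar> + 1)) \<le> c * (of_int m + a)\<^sup>2"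
    using assms by (intro mult_left_mono) auto
  then have "exp (- c * (of_int m + a)\<^sup>2) \<le> exp (c * (\<bar>a\<bar> + 1) + \<bar>of_int m\<bar> * (- c))"
    by (simp add: algebra_simps)
  also have "\<bar>of_int m\<bar> = real (nat \<bar>m\<bar>)"
    by simp
  finally show "exp (- c * (of_int m + a)\<^sup>2) \<le> exp (c * (\<bar>a\<bar> + 1)) * exp (- c) ^ nat \<bar>m\<bar>"
    unfolding exp_add exp_of_nat_mult .
qed auto

lemma theta_term_abs_summable:
  assumes "Im \<tau> > 0"
  shows "(\<lambda>m. norm (theta_term a v \<tau> m)) summable_on UNIV"
  unfolding norm_theta_term using assms by (intro summable_on_gaussian) auto

text \<open>
  On a disc of radius half the height of its centre, the imaginary part stays above that half height,
  and the Gaussian series at that height is a common majorant.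
\<close>

lemma theta_char_holomorphic:
  "theta_char a v holomorphic_on upper_half_plane"
proof -
  have "theta_char a v analytic_on upper_half_plane"
    unfolding analytic_on_def
  proof
    fix \<tau> assume "\<tau> \<in> upper_half_plane"
    then have \<tau>: "Im \<tau> > 0" by (simp add: upper_half_plane_def)
    define e where "e = Im \<tau> / 2"
    have e: "e > 0" using \<tau> by (simp add: e_def)
    have "uniform_limit (cball \<tau> e) (\<lambda>X \<sigma>. \<Sum>m\<in>X. theta_term a v \<sigma> m)
            (\<lambda>\<sigma>. \<Sum>\<^sub>\<infinity>m. theta_term a v \<sigma> m) (finite_subsets_at_top UNIV)"
    proof (rule Weierstrass_m_test_general)
      show "(\<lambda>m. exp (- (2 * pi * e) * (of_int m + a)\<^sup>2)) summable_on UNIV"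
        using e by (intro summable_on_gaussian) auto
      fix m :: int and \<sigma> assume "\<sigma> \<in> cball \<tau> e"
      then have "\<bar>Im (\<tau> - \<sigma>)\<bar> \<le> e"
        using abs_Im_le_cmod[of "\<tau> - \<sigma>"] by (simp add: dist_norm)
      then have "Im \<tau> - Im \<sigma> \<le> e" by (simp add: abs_le_iff)
      then have "e \<le> Im \<sigma>" by (simp add: e_def)
      then show "norm (theta_term a v \<sigma> m) \<le> exp (- (2 * pi * e) * (of_int m + a)\<^sup>2)"
        by (auto simp: norm_theta_term intro!: mult_right_mono)
    qed
    then have "uniform_limit (cball \<tau> e) (\<lambda>X \<sigma>. \<Sum>m\<in>X. theta_term a v \<sigma> m)
            (theta_char a v) (finite_subsets_at_top UNIV)"
      by (simp add: theta_char_def[abs_def])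
    moreover have "\<forall>\<^sub>F X in finite_subsets_at_top UNIV.
        continuous_on (cball \<tau> e) (\<lambda>\<sigma>. \<Sum>m\<in>X. theta_term a v \<sigma> m) \<and>
        (\<lambda>\<sigma>. \<Sum>m\<in>X. theta_term a v \<sigma> m) holomorphic_on ball \<tau> e"
      unfolding theta_term_def
      by (intro always_eventually allI conjI continuous_intros holomorphic_intros)
    ultimately have "theta_char a v holomorphic_on ball \<tau> e"
      using holomorphic_uniform_limit[of \<tau> e _ "finite_subsets_at_top UNIV" "theta_char a v"]
      by (metis finite_subsets_at_top_neq_bot)
    with e show "\<exists>e>0. theta_char a v holomorphic_on ball \<tau> e" by blast
  qed
  then show ?thesis by (rule analytic_imp_holomorphic)
qed

section \<open>Periodicity and parity\<close>

lemma theta_char_shift: "theta_char (a + 1) v \<tau> = theta_char a v \<tau>"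
  unfolding theta_char_def
  by (rule infsum_reindex_bij_witness[of _ "\<lambda>m. m - 1" "\<lambda>m. m + 1"])
     (auto simp: theta_term_def algebra_simps)

lemma theta_char_minus: "theta_char (- a) (- v) \<tau> = theta_char a v \<tau>"
  unfolding theta_char_def
  by (rule infsum_reindex_bij_witness[of _ uminus uminus])
     (auto simp: theta_term_def algebra_simps power2_eq_square)

lemma theta_char_add_pi:
  "theta_char a (v + pi) \<tau> = exp (2 * \<i> * of_real (a * pi)) * theta_char a v \<tau>"
proof -
  have "theta_term a (v + pi) \<tau> m = exp (2 * \<i> * of_real (a * pi)) * theta_term a v \<tau> m" for m
  proof -
    have "exp (2 * \<i> * of_real ((of_int m + a) * (v + pi))) =
            exp (2 * \<i> * of_real (a * pi)) * exp (2 * \<i> * of_real ((of_int m + a) * v)) *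
            exp (2 * of_int m * of_real pi * \<i>)"
      unfolding exp_add[symmetric] by (rule arg_cong[of _ _ exp]) (simp add: algebra_simps)
    also have "exp (2 * of_int m * of_real pi * \<i>) = 1"
      using exp_integer_2pi[of "of_int m"] by simp
    finally show ?thesis by (simp add: theta_term_def)
  qed
  then have "theta_term a (v + pi) \<tau> = (\<lambda>m. exp (2 * \<i> * of_real (a * pi)) * theta_term a v \<tau> m)"
    by (intro ext)
  then show ?thesis
    unfolding theta_char_def by (simp only: infsum_cmult_right')
qed

section \<open>Products\<close>

lemma theta_term_product_summable:
  assumes "Im \<tau> > 0"
  shows "(\<lambda>(m, n). theta_term a x \<tau> m * theta_term b y \<tau> n) summable_on UNIV \<times> UNIV"
proof (rule abs_summable_summable)
  show "(\<lambda>mn. norm (case mn of (m, n) \<Rightarrow> theta_term a x \<tau> m * theta_term b y \<tau> n))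
          summable_on UNIV \<times> UNIV"
    unfolding Infinite_Sum.abs_summable_on_Sigma_iff
    using theta_term_abs_summable[OF assms, of a x] theta_term_abs_summable[OF assms, of b y]
    by (auto simp: norm_mult infsum_cmult_right' abs_mult
             intro!: summable_on_cmult_right summable_on_cmult_left infsum_nonneg)
qed

lemma theta_char_product_eq_infsum:
  assumes "Im \<tau> > 0"
  shows "theta_char a x \<tau> * theta_char b y \<tau> =
           (\<Sum>\<^sub>\<infinity>(m, n)\<in>UNIV \<times> UNIV. theta_term a x \<tau> m * theta_term b y \<tau> n)"
  using infsum_Sigma'_banach[of "\<lambda>m n. theta_term a x \<tau> m * theta_term b y \<tau> n" UNIV "\<lambda>_. UNIV"]
    theta_term_product_summable[OF assms, of a x b y]
  by (simp add: theta_char_def infsum_cmult_right' infsum_cmult_left')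

text \<open>
  With s = j + c and t = k + d this is \<open>(s+t)\<^sup>2 + (s-t)\<^sup>2 = 2(s\<^sup>2 + t\<^sup>2)\<close> for the exponents of q,
  and (s+t)x + (s-t)y = s(x+y) + t(x-y) for the arguments.
\<close>

lemma theta_term_product:
  assumes m: "of_int m + a = (of_int j + c) + (of_int k + d)"
    and n: "of_int n + b = (of_int j + c) - (of_int k + d)"
  shows "theta_term a x \<tau> m * theta_term b y \<tau> n =
           theta_term c (x + y) (2 * \<tau>) j * theta_term d (x - y) (2 * \<tau>) k"
proof -
  define s t where "s = of_int j + c" and "t = of_int k + d"
  show ?thesis
    unfolding theta_term_def m n s_def[symmetric] t_def[symmetric]
    by (simp add: power2_eq_square algebra_simps flip: exp_add)
qed

text \<open>
  The lattice of pairs (m,n) splits into the cosets m + n even and m + n odd of the index-two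
  sublattice that consists of the pairs (j+k,j-k). Each coset gives one of the two products.
\<close>

lemma theta_char_product:
  assumes "Im \<tau> > 0"
  shows "theta_char a x \<tau> * theta_char b y \<tau> =
           theta_char ((a + b) / 2) (x + y) (2 * \<tau>) * theta_char ((a - b) / 2) (x - y) (2 * \<tau>) +
           theta_char ((a + b + 1) / 2) (x + y) (2 * \<tau>) *
             theta_char ((a - b + 1) / 2) (x - y) (2 * \<tau>)"
proof -
  define P where "P = (\<lambda>(m, n). theta_term a x \<tau> m * theta_term b y \<tau> n)"
  define E where "E = {(m::int, n::int). even (m + n)}"
  have P: "P summable_on UNIV"
    using theta_term_product_summable[OF assms, of a x b y]
    by (simp add: P_def)
  have \<tau>2: "Im (2 * \<tau>) > 0" using assms by simp
  have "infsum P E = (\<Sum>\<^sub>\<infinity>jk\<in>UNIV \<times> UNIV. P (case jk of (j, k) \<Rightarrow> (j + k, j - k)))"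
  proof (rule infsum_reindex_bij_betw[symmetric])
    show "bij_betw (\<lambda>(j, k). (j + k, j - k)) (UNIV \<times> UNIV) E"
      by (rule bij_betw_byWitness[of _ "\<lambda>(m, n). ((m + n) div 2, (m - n) div 2)"])
         (auto simp: E_def algebra_simps, presburger+)
  qed
  also have "\<dots> = (\<Sum>\<^sub>\<infinity>(j, k)\<in>UNIV \<times> UNIV. theta_term ((a + b) / 2) (x + y) (2 * \<tau>) j *
             theta_term ((a - b) / 2) (x - y) (2 * \<tau>) k)"
    by (rule infsum_cong, clarsimp simp: P_def simp del: mult.commute, rule theta_term_product)
       (simp_all add: field_simps)
  finally have even: "infsum P E = \<dots>" .
  have "infsum P (- E) = (\<Sum>\<^sub>\<infinity>jk\<in>UNIV \<times> UNIV. P (case jk of (j, k) \<Rightarrow> (j + k + 1, j - k)))"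
  proof (rule infsum_reindex_bij_betw[symmetric])
    show "bij_betw (\<lambda>(j, k). (j + k + 1, j - k)) (UNIV \<times> UNIV) (- E)"
      by (rule bij_betw_byWitness[of _ "\<lambda>(m, n). ((m + n) div 2, (m - n) div 2)"])
         (auto simp: E_def algebra_simps, presburger+)
  qed
  also have "\<dots> = (\<Sum>\<^sub>\<infinity>(j, k)\<in>UNIV \<times> UNIV. theta_term ((a + b + 1) / 2) (x + y) (2 * \<tau>) j *
             theta_term ((a - b + 1) / 2) (x - y) (2 * \<tau>) k)"
    by (rule infsum_cong, clarsimp simp: P_def simp del: mult.commute, rule theta_term_product)
       (simp_all add: field_simps)
  finally have odd: "infsum P (- E) = \<dots>" .
  have "infsum P UNIV = infsum P E + infsum P (- E)"
    using infsum_Un_disjoint[of P E "- E"] summable_on_subset_banach[OF P] by auto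
  then show ?thesis
    unfolding theta_char_product_eq_infsum[OF assms] theta_char_product_eq_infsum[OF \<tau>2]
    by (simp only: even odd P_def[symmetric] UNIV_Times_UNIV)
qed

lemma theta_term_quadruple:
  assumes "of_int m + a = 2 * (of_int j + c)"
  shows "theta_term c (2 * v) (4 * \<tau>) j = theta_term a v \<tau> m"
  unfolding theta_term_def assms power_mult_distrib by (simp add: mult_ac)

text \<open>
  Splitting the series into even and odd m.
\<close>

lemma theta_char_split:
  assumes "Im \<tau> > 0"
  shows "theta_char a v \<tau> = theta_char (a / 2) (2 * v) (4 * \<tau>) + theta_char ((a + 1) / 2) (2 * v) (4 * \<tau>)"
proof -
  have sm: "theta_term a v \<tau> summable_on UNIV"
    using theta_term_abs_summable[OF assms] by (rule abs_summable_summable)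
  have "infsum (theta_term a v \<tau>) {m. even m} = theta_char (a / 2) (2 * v) (4 * \<tau>)"
    unfolding theta_char_def
    by (rule infsum_reindex_bij_witness[of _ "\<lambda>m. 2 * m" "\<lambda>m. m div 2"])
       (auto intro!: theta_term_quadruple elim!: evenE)
  moreover have "infsum (theta_term a v \<tau>) {m. odd m} = theta_char ((a + 1) / 2) (2 * v) (4 * \<tau>)"
    unfolding theta_char_def
    by (rule infsum_reindex_bij_witness[of _ "\<lambda>m. 2 * m + 1" "\<lambda>m. m div 2"])
       (auto intro!: theta_term_quadruple elim!: oddE)
  moreover have "{m::int. even m} \<union> {m. odd m} = UNIV" by auto
  ultimately show ?thesis
    using infsum_Un_disjoint[of "theta_term a v \<tau>" "{m. even m}" "{m. odd m}"]
      summable_on_subset_banach[OF sm]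
    by (auto simp: theta_char_def)
qed


section \<open>Behaviour at the cusp\<close>

text \<open>
  The set F collects the indices where the exponent of q takes its least value \<open>a\<^sup>2\<close>. As all other
  exponents exceed it by at least 1, passing from height 1 to height y multiplies every term of
  the remainder by at most \<open>exp(2\<pi>(1-y))\<close>, so the remainder is at most this factor times its
  absolute sum at height 1. Dividing by \<open>q\<close> to the power \<open>a\<^sup>2\<close> leaves the terms of F.
\<close>

lemma theta_char_at_cusp:
  assumes F: "finite F"
    and least: "\<And>m. m \<in> F \<Longrightarrow> (of_int m + a)\<^sup>2 = a\<^sup>2"
    and others: "\<And>m. m \<notin> F \<Longrightarrow> (of_int m + a)\<^sup>2 \<ge> a\<^sup>2 + 1"
  shows "((\<lambda>\<tau>. theta_char a v \<tau> / exp (2 * of_real pi * \<i> * of_real (a\<^sup>2) * \<tau>)) \<longlongrightarrow>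
           (\<Sum>m\<in>F. exp (2 * \<i> * of_real ((of_int m + a) * v)))) (filtercomap Im at_top)"
proof -
  define S where "S = (\<Sum>m\<in>F. exp (2 * \<i> * of_real ((of_int m + a) * v)))"
  define Q where "Q = (\<lambda>\<tau>. exp (2 * of_real pi * \<i> * of_real (a\<^sup>2) * \<tau>))"
  define M where "M = (\<lambda>m::int. exp (2 * pi * a\<^sup>2) * exp (- (2 * pi) * (of_int m + a)\<^sup>2))"
  define C where "C = infsum M (- F)"
  have "M summable_on UNIV"
    unfolding M_def by (intro summable_on_cmult_right summable_on_gaussian) simp
  then have "M summable_on (- F)"
    by (rule summable_on_subset_banach) auto
  then have M: "(M has_sum C) (- F)"
    unfolding C_def by (rule has_sum_infsum)
  have bound: "norm (theta_char a v \<tau> / Q \<tau> - S) \<le> exp (2 * pi * (1 - Im \<tau>)) * C" if \<tau>: "Im \<tau> \<ge> 1" for \<tau>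
  proof (rule norm_infsum_le)
    have "(theta_term a v \<tau> has_sum theta_char a v \<tau>) UNIV"
      unfolding theta_char_def
      using theta_term_abs_summable[of \<tau> a v] \<tau> abs_summable_summable by (intro has_sum_infsum) auto
    then have "((\<lambda>m. theta_term a v \<tau> m / Q \<tau>) has_sum theta_char a v \<tau> / Q \<tau>) UNIV"
      by (rule has_sum_divide_const)
    moreover have "((\<lambda>m. theta_term a v \<tau> m / Q \<tau>) has_sum S) F"
      unfolding S_def using F by (intro has_sum_finiteI) (auto simp: theta_term_def Q_def least)
    ultimately have "((\<lambda>m. theta_term a v \<tau> m / Q \<tau>) has_sum theta_char a v \<tau> / Q \<tau> - S) (UNIV - F)"
      by (rule has_sum_Diff) auto
    then show "((\<lambda>m. theta_term a v \<tau> m / Q \<tau>) has_sum theta_char a v \<tau> / Q \<tau> - S) (- F)"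
      by (simp add: Compl_eq_Diff_UNIV)
    show "((\<lambda>m. exp (2 * pi * (1 - Im \<tau>)) * M m) has_sum exp (2 * pi * (1 - Im \<tau>)) * C) (- F)"
      by (intro has_sum_cmult_right M)
    fix m assume "m \<in> - F"
    then have "0 \<le> (Im \<tau> - 1) * ((of_int m + a)\<^sup>2 - a\<^sup>2 - 1)"
      using others[of m] \<tau> by (intro mult_nonneg_nonneg) auto
    then have "0 \<le> (2 * pi) * ((Im \<tau> - 1) * ((of_int m + a)\<^sup>2 - a\<^sup>2 - 1))"
      by simp
    then show "norm (theta_term a v \<tau> m / Q \<tau>) \<le> exp (2 * pi * (1 - Im \<tau>)) * M m"
      unfolding norm_divide norm_theta_term M_def Q_def norm_exp_eq_Re exp_diff[symmetric] exp_add[symmetric] exp_le_cancel_iff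
      by (simp add: algebra_simps)
  qed
  have "((\<lambda>y. exp (2 * pi * (1 - y)) * C) \<longlongrightarrow> 0) at_top"
    by real_asymp
  then have lim: "((\<lambda>\<tau>. exp (2 * pi * (1 - Im \<tau>)) * C) \<longlongrightarrow> 0) (filtercomap Im at_top)"
    by (rule filterlim_compose[OF _ filterlim_filtercomap])
  have "\<forall>\<^sub>F \<tau> in filtercomap Im at_top. Im \<tau> \<ge> 1"
    by (intro eventually_filtercomapI eventually_ge_at_top)
  then have "\<forall>\<^sub>F \<tau> in filtercomap Im at_top.
      norm (theta_char a v \<tau> / Q \<tau> - S) \<le> exp (2 * pi * (1 - Im \<tau>)) * C"
    by eventually_elim (rule bound)
  from Lim_null_comparison[OF this lim] show ?thesis
    unfolding S_def Q_def by (simp add: LIM_zero_iff)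
qed

text \<open>
  A zero at \<open>\<tau>\<close> propagates to \<open>2\<^sup>n\<tau>\<close> for all n, a sequence that tends to the cusp.
\<close>

lemma nonzero_by_doubling:
  assumes double: "\<And>\<tau>. Im \<tau> > 0 \<Longrightarrow> f \<tau> = 0 \<Longrightarrow> f (2 * \<tau>) = 0"
    and lim: "((\<lambda>\<tau>. f \<tau> / g \<tau>) \<longlongrightarrow> (L :: complex)) (filtercomap Im at_top)"
    and "L \<noteq> 0" and \<tau>: "Im \<tau> > 0"
  shows "f \<tau> \<noteq> 0"
proof
  assume "f \<tau> = 0"
  have "Im (2 ^ n * \<tau>) = 2 ^ n * Im \<tau>" for n
    by (induction n) auto
  then have "filterlim (\<lambda>n. 2 ^ n * \<tau>) (filtercomap Im at_top) sequentially"
    unfolding filterlim_filtercomap_iff o_def using \<tau> by (simp only:) real_asymp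
  with lim have "(\<lambda>n. f (2 ^ n * \<tau>) / g (2 ^ n * \<tau>)) \<longlonglongrightarrow> L"
    by (rule filterlim_compose)
  moreover have "f (2 ^ n * \<tau>) = 0" for n
  proof (induction n)
    case (Suc n)
    have "Im (2 ^ n * \<tau>) > 0" using \<open>Im (2 ^ n * \<tau>) = 2 ^ n * Im \<tau>\<close> \<tau> by simp
    from double[OF this Suc.IH] show ?case by (simp add: mult_ac)
  qed (simp add: \<open>f \<tau> = 0\<close>)
  ultimately have "(\<lambda>n::nat. 0) \<longlonglongrightarrow> L" by simp
  with \<open>L \<noteq> 0\<close> show False by (simp add: LIMSEQ_const_iff)
qed

section \<open>Duplication formulas and non-vanishing of the null values\<close>

abbreviation th2 :: "real \<Rightarrow> complex \<Rightarrow> complex" where "th2 \<equiv> theta_char (1/2)"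
abbreviation th3 :: "real \<Rightarrow> complex \<Rightarrow> complex" where "th3 \<equiv> theta_char 0"

lemma theta_char_1: "theta_char 1 v \<tau> = th3 v \<tau>"
  using theta_char_shift[of 0 v \<tau>] by simp

lemma th2_minus: "th2 (- v) \<tau> = th2 v \<tau>"
  using theta_char_minus[of "1/2" v \<tau>] theta_char_shift[of "- (1/2)" "- v" \<tau>] by simp

lemma th3_minus: "th3 (- v) \<tau> = th3 v \<tau>"
  using theta_char_minus[of 0 v \<tau>] by simp

lemma th2_add_pi: "th2 (v + pi) \<tau> = - th2 v \<tau>"
  using theta_char_add_pi[of "1/2" v \<tau>] by simp

lemma th3_add_pi: "th3 (v + pi) \<tau> = th3 v \<tau>"
  using theta_char_add_pi[of 0 v \<tau>] by simp

lemma th2_pi_half: "th2 (pi/2) \<tau> = 0"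
  using th2_add_pi[of "- (pi/2)" \<tau>] th2_minus[of "pi/2" \<tau>] by simp

lemma th3_mult_th3:
  assumes "Im \<tau> > 0"
  shows "th3 x \<tau> * th3 y \<tau> =
           th3 (x + y) (2 * \<tau>) * th3 (x - y) (2 * \<tau>) + th2 (x + y) (2 * \<tau>) * th2 (x - y) (2 * \<tau>)"
  using theta_char_product[OF assms, of 0 x 0 y] by simp

lemma th2_mult_th2:
  assumes "Im \<tau> > 0"
  shows "th2 x \<tau> * th2 y \<tau> =
           th2 (x + y) (2 * \<tau>) * th3 (x - y) (2 * \<tau>) + th3 (x + y) (2 * \<tau>) * th2 (x - y) (2 * \<tau>)"
  using theta_char_product[OF assms, of "1/2" x "1/2" y] by (simp add: theta_char_1)

lemma th3_split:
  assumes "Im \<tau> > 0"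
  shows "th3 v \<tau> = th3 (2 * v) (4 * \<tau>) + th2 (2 * v) (4 * \<tau>)"
  using theta_char_split[OF assms, of 0 v] by simp

text \<open>
  The value at \<open>\<pi>/2\<close> is the classical \<open>\<vartheta>\<^sub>4(0)\<close>. Since its square at \<open>2\<tau>\<close> has the value
  at \<open>\<tau>\<close> as a factor, its zeros propagate by doubling, and as the other factor is \<open>\<vartheta>\<^sub>3(0,\<tau>)\<close>,
  its non-vanishing implies that of \<open>\<vartheta>\<^sub>3(0,\<tau>)\<close>.
\<close>

lemma th3_0_mult_th3_pi_half:
  assumes "Im \<tau> > 0"
  shows "th3 0 \<tau> * th3 (pi/2) \<tau> = (th3 (pi/2) (2 * \<tau>))\<^sup>2"
  using th3_mult_th3[OF assms, of 0 "pi/2"]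
  by (simp add: th2_pi_half th3_minus power2_eq_square)

lemma th3_pi_half_nonzero:
  assumes "Im \<tau> > 0"
  shows "th3 (pi/2) \<tau> \<noteq> 0"
proof (rule nonzero_by_doubling[OF _ _ _ assms])
  fix \<tau> :: complex
  assume "Im \<tau> > 0" "th3 (pi/2) \<tau> = 0"
  then show "th3 (pi/2) (2 * \<tau>) = 0"
    using th3_0_mult_th3_pi_half[of \<tau>] by simp
next
  show "((\<lambda>\<tau>. th3 (pi/2) \<tau> / 1) \<longlongrightarrow> 1) (filtercomap Im at_top)"
  proof -
    have "1 \<le> (real_of_int m)\<^sup>2" if "m \<noteq> 0" for m
    proof -
      from that have "1 \<le> m\<^sup>2" by (simp add: int_one_le_iff_zero_less)
      then show ?thesis unfolding of_int_power[symmetric] of_int_1_le_iff .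
    qed
    then show ?thesis
      using theta_char_at_cusp[of "{0}" 0 "pi/2"] by simp
  qed
qed auto

lemma th3_0_nonzero:
  assumes "Im \<tau> > 0"
  shows "th3 0 \<tau> \<noteq> 0"
  using th3_0_mult_th3_pi_half[OF assms] th3_pi_half_nonzero[of "2 * \<tau>"] assms by auto

lemma th2_0_squared:
  assumes "Im \<tau> > 0"
  shows "(th2 0 \<tau>)\<^sup>2 = 2 * th2 0 (2 * \<tau>) * th3 0 (2 * \<tau>)"
  using th2_mult_th2[OF assms, of 0 0] by (simp add: power2_eq_square)

lemma th2_0_nonzero:
  assumes "Im \<tau> > 0"
  shows "th2 0 \<tau> \<noteq> 0"
proof (rule nonzero_by_doubling[OF _ _ _ assms])
  fix \<tau> :: complex
  assume "Im \<tau> > 0" "th2 0 \<tau> = 0"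
  then show "th2 0 (2 * \<tau>) = 0"
    using th2_0_squared[of \<tau>] th3_0_nonzero[of "2 * \<tau>"] by simp
next
  show "((\<lambda>\<tau>. th2 0 \<tau> / exp (2 * of_real pi * \<i> * of_real ((1/2)\<^sup>2) * \<tau>)) \<longlongrightarrow> 2) (filtercomap Im at_top)"
  proof -
    have "(real_of_int m + 1/2)\<^sup>2 \<ge> (1/2)\<^sup>2 + 1" if "m \<notin> {-1, 0}" for m
    proof -
      from that consider "m \<ge> 1" | "m \<le> -2" by force
      then have "m * (m + 1) \<ge> 1"
      proof cases
        case 1
        then show ?thesis using mult_mono[of 1 m 1 "m + 1"] by simp
      next
        case 2
        then show ?thesis using mult_mono[of 1 "- m" 1 "- (m + 1)"] by (simp add: algebra_simps)
      qed
      then have "real_of_int (m * (m + 1)) \<ge> 1" by linarith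
      then show ?thesis by (simp add: power2_eq_square algebra_simps)
    qed
    moreover have "(real_of_int m + 1/2)\<^sup>2 = (1/2)\<^sup>2" if "m \<in> {-1, 0}" for m
      using that by (auto simp: power2_eq_square)
    ultimately show ?thesis
      using theta_char_at_cusp[of "{-1, 0}" "1/2" 0] by simp
  qed
qed auto

section \<open>Theta values at odd multiples of pi/8\<close>

lemma theta_quarter_squares:
  assumes \<tau>: "Im \<tau> > 0"
  shows "(th2 (pi/4) \<tau>)\<^sup>2 = th3 (pi/2) (2*\<tau>) * th2 0 (2*\<tau>)"
    and "(th3 (pi/4) \<tau>)\<^sup>2 = th3 (pi/2) (2*\<tau>) * th3 0 (2*\<tau>)"
  using th2_mult_th2[OF \<tau>, of "pi/4" "pi/4"] th3_mult_th3[OF \<tau>, of "pi/4" "pi/4"]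
  by (simp_all add: th2_pi_half power2_eq_square)

text \<open>
  In both duplication formulas the term containing \<open>\<vartheta>\<^sub>2(3\<pi>/8 + \<pi>/8) = 0\<close> drops out.
\<close>

lemma theta_eighth_products:
  assumes \<tau>: "Im \<tau> > 0"
  shows "th2 (pi/8) \<tau> * th2 (3*pi/8) \<tau> = th3 (pi/2) (2*\<tau>) * th2 (pi/4) (2*\<tau>)"
    and "th3 (pi/8) \<tau> * th3 (3*pi/8) \<tau> = th3 (pi/2) (2*\<tau>) * th3 (pi/4) (2*\<tau>)"
proof -
  have sum: "3*pi/8 + pi/8 = pi/2" and diff: "3*pi/8 - pi/8 = pi/4" by simp_all
  show "th2 (pi/8) \<tau> * th2 (3*pi/8) \<tau> = th3 (pi/2) (2*\<tau>) * th2 (pi/4) (2*\<tau>)"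
    using th2_mult_th2[OF \<tau>, of "3*pi/8" "pi/8"] unfolding sum diff by (simp add: th2_pi_half mult_ac)
  show "th3 (pi/8) \<tau> * th3 (3*pi/8) \<tau> = th3 (pi/2) (2*\<tau>) * th3 (pi/4) (2*\<tau>)"
    using th3_mult_th3[OF \<tau>, of "3*pi/8" "pi/8"] unfolding sum diff by (simp add: th2_pi_half mult_ac)
qed

text \<open>
  The duplication formulas with x = y express each square through the values at 0 and at \<open>\<pi>/4\<close>,
  respectively \<open>3\<pi>/4\<close>, at the parameter \<open>2\<tau>\<close>. Since \<open>3\<pi>/4 = -\<pi>/4 + \<pi>\<close>, passing from \<open>\<pi>/8\<close> to
  \<open>3\<pi>/8\<close> only changes the sign of \<open>\<vartheta>\<^sub>2(\<pi>/4,2\<tau>)\<close>. The left-hand side is symmetric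
  under this change of sign, so only even powers of that value survive.
\<close>

lemma theta_quotient_sum:
  assumes \<tau>: "Im \<tau> > 0"
  shows "(th2 (pi/8) \<tau>)\<^sup>2 * (th3 (3*pi/8) \<tau>)\<^sup>2 + (th2 (3*pi/8) \<tau>)\<^sup>2 * (th3 (pi/8) \<tau>)\<^sup>2 =
           (th2 0 \<tau>)\<^sup>2 * th3 (pi/2) (4*\<tau>) * (th3 0 (4*\<tau>) - th2 0 (4*\<tau>))"
proof -
  define a b A B where "a = th2 (pi/4) (2*\<tau>)" and "b = th3 (pi/4) (2*\<tau>)"
    and "A = th2 0 (2*\<tau>)" and "B = th3 0 (2*\<tau>)"
  have \<tau>2: "Im (2 * \<tau>) > 0" using \<tau> by simp
  have v: "pi/8 + pi/8 = pi/4" "3*pi/8 + 3*pi/8 = - (pi/4) + pi" by simp_all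
  have "(th2 (pi/8) \<tau>)\<^sup>2 = a * B + b * A" "(th3 (pi/8) \<tau>)\<^sup>2 = b * B + a * A"
    using th2_mult_th2[OF \<tau>, of "pi/8" "pi/8"] th3_mult_th3[OF \<tau>, of "pi/8" "pi/8"]
    unfolding v a_def b_def A_def B_def by (simp_all add: power2_eq_square)
  moreover have "(th2 (3*pi/8) \<tau>)\<^sup>2 = b * A - a * B" "(th3 (3*pi/8) \<tau>)\<^sup>2 = b * B - a * A"
    using th2_mult_th2[OF \<tau>, of "3*pi/8" "3*pi/8"] th3_mult_th3[OF \<tau>, of "3*pi/8" "3*pi/8"]
    unfolding v th2_add_pi th3_add_pi th2_minus th3_minus a_def b_def A_def B_def
    by (simp_all add: power2_eq_square)
  ultimately have "(th2 (pi/8) \<tau>)\<^sup>2 * (th3 (3*pi/8) \<tau>)\<^sup>2 + (th2 (3*pi/8) \<tau>)\<^sup>2 * (th3 (pi/8) \<tau>)\<^sup>2 =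
      2 * A * B * (b\<^sup>2 - a\<^sup>2)"
    by (simp only:) (simp add: power2_eq_square algebra_simps)
  then show ?thesis
    unfolding a_def b_def A_def B_def theta_quarter_squares[OF \<tau>2] th2_0_squared[OF \<tau>]
    by (simp add: algebra_simps)
qed

lemma theta_null_values:
  assumes \<tau>: "Im \<tau> > 0"
  shows "th3 0 \<tau> = th3 0 (4*\<tau>) + th2 0 (4*\<tau>)"
    and "th3 (pi/2) \<tau> = th3 0 (4*\<tau>) - th2 0 (4*\<tau>)"
    and "(th2 0 \<tau>)^4 = 8 * th2 0 (4*\<tau>) * th3 0 (4*\<tau>) * ((th3 0 (4*\<tau>))\<^sup>2 + (th2 0 (4*\<tau>))\<^sup>2)"
proof -
  have \<tau>2: "Im (2 * \<tau>) > 0" using \<tau> by simp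
  show "th3 0 \<tau> = th3 0 (4*\<tau>) + th2 0 (4*\<tau>)"
    using th3_split[OF \<tau>, of 0] by simp
  show "th3 (pi/2) \<tau> = th3 0 (4*\<tau>) - th2 0 (4*\<tau>)"
    using th3_split[OF \<tau>, of "pi/2"] th2_add_pi[of 0] th3_add_pi[of 0] by simp
  have "(th3 0 (2*\<tau>))\<^sup>2 = (th3 0 (4*\<tau>))\<^sup>2 + (th2 0 (4*\<tau>))\<^sup>2"
    using th3_mult_th3[OF \<tau>2, of 0 0] by (simp add: power2_eq_square)
  moreover have "(th2 0 (2*\<tau>))\<^sup>2 = 2 * th2 0 (4*\<tau>) * th3 0 (4*\<tau>)"
    using th2_0_squared[OF \<tau>2] by simp
  moreover have "(th2 0 \<tau>)^4 = ((th2 0 \<tau>)\<^sup>2)\<^sup>2" by simp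
  ultimately show "(th2 0 \<tau>)^4 = 8 * th2 0 (4*\<tau>) * th3 0 (4*\<tau>) * ((th3 0 (4*\<tau>))\<^sup>2 + (th2 0 (4*\<tau>))\<^sup>2)"
    by (simp only: th2_0_squared[OF \<tau>] power_mult_distrib) simp
qed

lemma theta_char_meromorphic:
  assumes "c > 0"
  shows "(\<lambda>\<tau>. theta_char a v (of_real c * \<tau>)) meromorphic_on upper_half_plane"
proof -
  have op: "open upper_half_plane"
    unfolding upper_half_plane_def by (rule open_halfspace_Im_gt)
  have "(theta_char a v \<circ> (\<lambda>\<tau>. of_real c * \<tau>)) holomorphic_on upper_half_plane"
    by (intro holomorphic_on_compose_gen[OF _ theta_char_holomorphic] holomorphic_intros)
       (use assms in \<open>auto simp: upper_half_plane_def\<close>)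
  then show ?thesis
    using op by (auto simp: o_def analytic_on_open intro!: analytic_on_imp_meromorphic_on)
qed

theorem mainTheorem7:
  shows "meromorphic_identity_on upper_half_plane
           (\<lambda>\<tau>. (theta2 (of_real (pi/8)) \<tau>)\<^sup>2 / (theta3 (of_real (pi/8)) \<tau>)\<^sup>2
              + (theta2 (of_real (3*pi/8)) \<tau>)\<^sup>2 / (theta3 (of_real (3*pi/8)) \<tau>)\<^sup>2)
           (\<lambda>\<tau>. (8 * theta2 0 (4*\<tau>)) / ((theta2 0 \<tau>)\<^sup>2 * (theta3 0 \<tau>)\<^sup>2)
              * (((theta3 0 (4*\<tau>))^4 - (theta2 0 (4*\<tau>))^4)
                   / (theta3 0 (4*\<tau>) - theta2 0 (4*\<tau>))))
       \<and> meromorphic_identity_on upper_half_plane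
           (\<lambda>\<tau>. (theta2 (of_real (pi/8)) \<tau>)\<^sup>2 / (theta3 (of_real (pi/8)) \<tau>)\<^sup>2
              * ((theta2 (of_real (3*pi/8)) \<tau>)\<^sup>2 / (theta3 (of_real (3*pi/8)) \<tau>)\<^sup>2))
           (\<lambda>\<tau>. theta2 0 (4*\<tau>) / theta3 0 (4*\<tau>))"
proof -
  have zero: "theta2 0 \<tau> = th2 0 \<tau>" "theta3 0 \<tau> = th3 0 \<tau>" for \<tau>
    using theta2_eq_theta_char[of 0 \<tau>] theta3_eq_theta_char[of 0 \<tau>] by simp_all
  have mero: "theta_char a v meromorphic_on upper_half_plane"
    "(\<lambda>\<tau>. theta_char a v (4 * \<tau>)) meromorphic_on upper_half_plane" for a v
    using theta_char_meromorphic[of 1 a v] theta_char_meromorphic[of 4 a v] by simp_all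
  have sum_eq: "(th2 (pi/8) \<tau>)\<^sup>2 / (th3 (pi/8) \<tau>)\<^sup>2 + (th2 (3*pi/8) \<tau>)\<^sup>2 / (th3 (3*pi/8) \<tau>)\<^sup>2 =
      (8 * th2 0 (4*\<tau>)) / ((th2 0 \<tau>)\<^sup>2 * (th3 0 \<tau>)\<^sup>2)
        * (((th3 0 (4*\<tau>))^4 - (th2 0 (4*\<tau>))^4) / (th3 0 (4*\<tau>) - th2 0 (4*\<tau>)))"
    and prod_eq: "(th2 (pi/8) \<tau>)\<^sup>2 / (th3 (pi/8) \<tau>)\<^sup>2 * ((th2 (3*pi/8) \<tau>)\<^sup>2 / (th3 (3*pi/8) \<tau>)\<^sup>2) =
      th2 0 (4*\<tau>) / th3 0 (4*\<tau>)"
    if \<tau>: "Im \<tau> > 0" for \<tau>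
  proof -
    define p r S D N where "p = th2 0 (4*\<tau>)" and "r = th3 0 (4*\<tau>)"
      and "S = (th2 0 \<tau>)\<^sup>2" and "D = th3 (pi/2) (4*\<tau>)" and "N = (th3 (pi/2) (2*\<tau>))\<^sup>2"
    note null = theta_null_values[OF \<tau>, folded p_def r_def]
    have nz: "r \<noteq> 0" "S \<noteq> 0" "D \<noteq> 0" "N \<noteq> 0" "r + p \<noteq> 0" "r - p \<noteq> 0"
      using th3_0_nonzero[of "4*\<tau>"] th2_0_nonzero[OF \<tau>] th3_pi_half_nonzero[of "4*\<tau>"]
        th3_pi_half_nonzero[of "2*\<tau>"] th3_0_nonzero[OF \<tau>] th3_pi_half_nonzero[OF \<tau>] \<tau> null
      by (simp_all add: r_def S_def D_def N_def)
    have N: "N = (r + p) * (r - p)"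
      using th3_0_mult_th3_pi_half[OF \<tau>] null by (simp add: N_def)
    \<comment> \<open>Expanding the fraction by S lets the fourth power of the null value be eliminated.\<close>
    have SS: "S * S = 8 * p * r * (r\<^sup>2 + p\<^sup>2)"
      using null by (simp add: S_def flip: power_add)
    have den: "(th3 (pi/8) \<tau>)\<^sup>2 * (th3 (3*pi/8) \<tau>)\<^sup>2 = N * D * r"
      and num: "(th2 (pi/8) \<tau>)\<^sup>2 * (th2 (3*pi/8) \<tau>)\<^sup>2 = N * D * p"
      using theta_eighth_products[OF \<tau>] theta_quarter_squares[of "2*\<tau>"] \<tau>
      by (simp_all add: N_def D_def p_def r_def flip: power_mult_distrib) (simp_all add: power_mult_distrib)
    have den_nz: "th3 (pi/8) \<tau> \<noteq> 0" "th3 (3*pi/8) \<tau> \<noteq> 0"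
      using den nz by auto
    show "(th2 (pi/8) \<tau>)\<^sup>2 / (th3 (pi/8) \<tau>)\<^sup>2 * ((th2 (3*pi/8) \<tau>)\<^sup>2 / (th3 (3*pi/8) \<tau>)\<^sup>2) =
        th2 0 (4*\<tau>) / th3 0 (4*\<tau>)"
      unfolding times_divide_times_eq num den using nz by (simp add: p_def r_def)
    have "(th2 (pi/8) \<tau>)\<^sup>2 / (th3 (pi/8) \<tau>)\<^sup>2 + (th2 (3*pi/8) \<tau>)\<^sup>2 / (th3 (3*pi/8) \<tau>)\<^sup>2 =
        S * D * (r - p) / (N * D * r)"
      using den_nz theta_quotient_sum[OF \<tau>]
      by (simp add: add_frac_eq den S_def D_def p_def r_def)
    also have "\<dots> = S / ((r + p) * r)"
      using nz by (simp add: N)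
    also have "\<dots> = S * S / (S * (r + p) * r)"
      using nz by simp
    also have "\<dots> = 8 * p / (S * (r + p)\<^sup>2) * ((r^4 - p^4) / (r - p))"
    proof -
      have "r^4 - p^4 = (r\<^sup>2 + p\<^sup>2) * (r + p) * (r - p)"
        by (simp add: power2_eq_square power4_eq_xxxx algebra_simps)
      then show ?thesis
        unfolding SS using nz by (simp add: power2_eq_square)
    qed
    finally show "(th2 (pi/8) \<tau>)\<^sup>2 / (th3 (pi/8) \<tau>)\<^sup>2 + (th2 (3*pi/8) \<tau>)\<^sup>2 / (th3 (3*pi/8) \<tau>)\<^sup>2 =
      (8 * th2 0 (4*\<tau>)) / ((th2 0 \<tau>)\<^sup>2 * (th3 0 \<tau>)\<^sup>2)
        * (((th3 0 (4*\<tau>))^4 - (th2 0 (4*\<tau>))^4) / (th3 0 (4*\<tau>) - th2 0 (4*\<tau>)))"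
      unfolding null by (simp only: p_def r_def S_def)
  qed
  show ?thesis
    unfolding meromorphic_identity_on_def theta2_eq_theta_char theta3_eq_theta_char zero
    by (intro conjI ballI meromorphic_intros mero sum_eq prod_eq)
       (simp_all add: upper_half_plane_def)
qed

end
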